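(* Let $c>0$ be a constant and consider the free-boundary problem of finding $A,B$ and $\widehat V:[0,1]\to\mathbb R$ with (1) $\mathcal L\widehat V(x)=-c$ for $x\in(A,B)$; (2) $\widehat V(x)=g(x)$ for $x\in\{A,B\}$; (3) $\widehat V'(x)=g'(x)$ for $x\in\{A,B\}$; (4) $\widehat V(x)<g(x)$ for $x\in(A,B)$; (5) $\widehat V(x)=g(x)$ for $x\in[0,1]\setminus(A,B)$; (6) $0<A<B<1$. If conditions (A.i)–(A.iv) of the context hold and $\mathcal Lg(x_0)<-c$, then the free-boundary problem (1)–(6) admits a solution with $\widehat V\in C^2((0,1)\setminus\{A,B\})\cap C^1((0,1))$, and this solution is unique. If conditions (A.i)–(A.iv) hold and $\mathcal Lg(x_0)\ge-c$, then (1)–(5) (with $0<A\le B<1$) can only hold if $A=B$, that is, $\widehat V=g$.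
   Context: $\sigma:[0,1]\to[0,\infty)$ and $g:[0,1]\to[0,\infty)$ are given functions and $\mathcal L=\frac12\sigma^2(x)\partial_{xx}$. Conditions: (A.i) $\sigma$ is continuous on $[0,1]$, locally Lipschitz on $(0,1)$, $\sigma(x)=0$ iff $x\in\{0,1\}$, $\sigma^{-2}\in L^1_{\mathrm{loc}}((0,1))$, and for any $a\in(0,1)$, $\int_a^x\int_a^y\sigma^{-2}(z)\,dz\,dy\to\infty$ as $x\to0$ and as $x\to1$. (A.ii) the running cost is the positive constant $c$. (A.iii) $g\in C([0,1])\cap C^2((0,1))$ is concave and $g(x)=0$ iff $x\in\{0,1\}$. (A.iv) There is $x_0\in(0,1)$ such that $\mathcal Lg$ is strictly decreasing on $(0,x_0)$ and strictly increasing on $(x_0,1)$. *)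

theory Defs
  imports "HOL-Analysis.Analysis"
begin

definition generator :: "(real \<Rightarrow> real) \<Rightarrow> (real \<Rightarrow> real) \<Rightarrow> real \<Rightarrow> real" where
  "generator \<sigma> f x = 1/2 * (\<sigma> x)\<^sup>2 * deriv (deriv f) x"

text \<open>On an open set of reals, \<open>C\<^sup>1\<close> is the library's \<^const>\<open>C1_differentiable_on\<close>;
  the following is \<open>C\<^sup>2\<close> for open \<open>S\<close>.\<close>

definition C2_on :: "(real \<Rightarrow> real) \<Rightarrow> real set \<Rightarrow> bool" where
  "C2_on f S \<longleftrightarrow> f C1_differentiable_on S \<and> deriv f C1_differentiable_on S"

definition locally_integrable_on :: "(real \<Rightarrow> real) \<Rightarrow> real set \<Rightarrow> bool" where
  "locally_integrable_on f S \<longleftrightarrow>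
     (\<forall>K. compact K \<and> K \<subseteq> S \<longrightarrow> set_integrable lborel K f)"

text \<open>The coefficient functions live on \<open>[0,1]\<close>; their values elsewhere are irrelevant.
  In the last two conjuncts of the next definition the integrals are oriented, so that the
  double integral is nonnegative also for \<open>x < a\<close>.  The first argument of
  \<^const>\<open>local_lipschitz\<close> is a time domain, on which \<open>\<sigma>\<close> does not depend.\<close>

definition diffusion_condition :: "(real \<Rightarrow> real) \<Rightarrow> bool" where
  "diffusion_condition \<sigma> \<longleftrightarrow>
     (\<forall>x\<in>{0..1}. 0 \<le> \<sigma> x) \<and>
     continuous_on {0..1} \<sigma> \<and>
     local_lipschitz (UNIV :: real set) {0<..<1} (\<lambda>_. \<sigma>) \<and>
     (\<forall>x\<in>{0..1}. \<sigma> x = 0 \<longleftrightarrow> x \<in> {0, 1}) \<and>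
     locally_integrable_on (\<lambda>x. 1 / (\<sigma> x)\<^sup>2) {0<..<1} \<and>
     (\<forall>a\<in>{0<..<1}.
        filterlim (\<lambda>x. LBINT y=ereal a..ereal x. (LBINT z=ereal a..ereal y. 1 / (\<sigma> z)\<^sup>2))
          at_top (at_right 0) \<and>
        filterlim (\<lambda>x. LBINT y=ereal a..ereal x. (LBINT z=ereal a..ereal y. 1 / (\<sigma> z)\<^sup>2))
          at_top (at_left 1))"

definition obstacle_condition :: "(real \<Rightarrow> real) \<Rightarrow> bool" where
  "obstacle_condition g \<longleftrightarrow>
     (\<forall>x\<in>{0..1}. 0 \<le> g x) \<and>
     continuous_on {0..1} g \<and>
     C2_on g {0<..<1} \<and>
     concave_on {0..1} g \<and>
     (\<forall>x\<in>{0..1}. g x = 0 \<longleftrightarrow> x \<in> {0, 1})"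

definition unimodal_condition :: "(real \<Rightarrow> real) \<Rightarrow> (real \<Rightarrow> real) \<Rightarrow> real \<Rightarrow> bool" where
  "unimodal_condition \<sigma> g x0 \<longleftrightarrow>
     x0 \<in> {0<..<1} \<and>
     strict_antimono_on {0<..<x0} (generator \<sigma> g) \<and>
     strict_mono_on {x0<..<1} (generator \<sigma> g)"

text \<open>The free-boundary equations without the location of the boundary points.
  Existence of the derivatives occurring in the equations is demanded explicitly, because
  \<^const>\<open>deriv\<close> is total.\<close>

definition free_boundary_equations ::
  "(real \<Rightarrow> real) \<Rightarrow> (real \<Rightarrow> real) \<Rightarrow> real \<Rightarrow> real \<Rightarrow> real \<Rightarrow> (real \<Rightarrow> real) \<Rightarrow> bool" where
  "free_boundary_equations \<sigma> g c A B V \<longleftrightarrow>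
     (\<forall>x\<in>{A<..<B}. V differentiable at x \<and> deriv V differentiable at x \<and>
        generator \<sigma> V x = - c) \<and>
     (\<forall>x\<in>{A, B}. V x = g x) \<and>
     (\<forall>x\<in>{A, B}. V differentiable at x \<and> deriv V x = deriv g x) \<and>
     (\<forall>x\<in>{A<..<B}. V x < g x) \<and>
     (\<forall>x\<in>{0..1} - {A<..<B}. V x = g x)"

definition free_boundary_solution ::
  "(real \<Rightarrow> real) \<Rightarrow> (real \<Rightarrow> real) \<Rightarrow> real \<Rightarrow> real \<Rightarrow> real \<Rightarrow> (real \<Rightarrow> real) \<Rightarrow> bool" where
  "free_boundary_solution \<sigma> g c A B V \<longleftrightarrow>
     free_boundary_equations \<sigma> g c A B V \<and> 0 < A \<and> A < B \<and> B < 1"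

definition regular_solution ::
  "(real \<Rightarrow> real) \<Rightarrow> (real \<Rightarrow> real) \<Rightarrow> real \<Rightarrow> real \<Rightarrow> real \<Rightarrow> (real \<Rightarrow> real) \<Rightarrow> bool" where
  "regular_solution \<sigma> g c A B V \<longleftrightarrow>
     free_boundary_solution \<sigma> g c A B V \<and>
     C2_on V ({0<..<1} - {A, B}) \<and> V C1_differentiable_on {0<..<1}"

end

theory Submission
  imports Defs
begin

text \<open>Let \<open>P\<close> satisfy \<open>P'' = 1 / \<sigma>\<^sup>2\<close> and put \<open>G = g + 2 c P\<close>, so that
  \<open>G'' = 2 (\<L> g + c) / \<sigma>\<^sup>2\<close>, where \<open>\<L>\<close> is the generator.  The equation \<open>\<L> V = - c\<close> says that
  \<open>V + 2 c P\<close> is affine on \<open>(A,B)\<close>, and the boundary conditions say that this affine function is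
  tangent to \<open>G\<close> at \<open>A\<close> and \<open>B\<close> and lies below \<open>G\<close> in between.  A bitangent line exists because
  \<open>G\<close> tends to infinity at both ends of \<open>(0,1)\<close>.  It is unique because the sign pattern of \<open>G''\<close>
  forces \<open>A < x0 < B\<close> and puts the line below \<open>G\<close> on all of \<open>(0,1)\<close>: two such lines dominate each
  other on intervals around \<open>x0\<close>, hence coincide.  If \<open>\<L> g x0 \<ge> - c\<close>, then \<open>G\<close> is strictly convex
  and has no bitangent line.\<close>

section \<open>One-sided minima and supporting lines on an interval\<close>

text \<open>If \<open>d < 0\<close>, then \<open>f'\<close> is negative just to the right of
  \<open>a\<close>, and the mean value theorem pushes \<open>f\<close> below \<open>f a\<close>. The
  one-sided form is needed because a bitangent is at first known to lie below \<open>G\<close> only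
  between its contacts.\<close>

lemma DERIV_nonneg_at_right_min:
  fixes f f' :: "real \<Rightarrow> real"
  assumes "a < b"
    and f: "\<And>x. a \<le> x \<Longrightarrow> x < b \<Longrightarrow> (f has_real_derivative f' x) (at x)"
    and f': "(f' has_real_derivative d) (at a)" and "f' a = 0"
    and min: "\<And>x. a < x \<Longrightarrow> x < b \<Longrightarrow> f a \<le> f x"
  shows "0 \<le> d"
proof (rule ccontr)
  assume "\<not> 0 \<le> d"
  then obtain e where e: "e > 0" "\<And>h. 0 < h \<Longrightarrow> h < e \<Longrightarrow> f' (a + h) < f' a"
    using DERIV_neg_dec_right[OF f'] by auto
  define x where "x = a + min e (b - a) / 2"
  have "min e (b - a) / 2 < b - a"
    using e(1) \<open>a < b\<close> by (simp add: min_def)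
  then have x: "a < x" "x < b" "x - a < e"
    using e(1) \<open>a < b\<close> by (simp_all add: x_def min_def)
  obtain z where z: "a < z" "z < x" "f x - f a = (x - a) * f' z"
    using MVT2[of a x f f'] f x by force
  have "f' z < 0"
    using e(2)[of "z - a"] z x \<open>f' a = 0\<close> by simp
  then have "f x < f a"
    using z x(1) by (smt (verit) mult_pos_neg)
  with min[OF x(1,2)] show False by simp
qed

lemma DERIV_nonneg_at_left_min:
  fixes f f' :: "real \<Rightarrow> real"
  assumes "a < b"
    and f: "\<And>x. a < x \<Longrightarrow> x \<le> b \<Longrightarrow> (f has_real_derivative f' x) (at x)"
    and f': "(f' has_real_derivative d) (at b)" and "f' b = 0"
    and min: "\<And>x. a < x \<Longrightarrow> x < b \<Longrightarrow> f b \<le> f x"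
  shows "0 \<le> d"
proof (rule DERIV_nonneg_at_right_min[of "-b" "-a" "\<lambda>x. f (-x)" "\<lambda>x. - f' (-x)"])
  show "((\<lambda>x. f (-x)) has_real_derivative - f' (-x)) (at x)" if "-b \<le> x" "x < -a" for x
    using DERIV_mirror[of f "f' (-x)" x] f[of "-x"] that by simp
  show "((\<lambda>x. - f' (-x)) has_real_derivative d) (at (-b))"
    using DERIV_minus[OF iffD1[OF DERIV_mirror[of f' d "-b"]]] f' by simp
qed (use assms in auto)

text \<open>Near \<open>l\<close> the function is at least \<open>f c\<close>, so a minimum over the
  compact rest of the interval is a minimum over the whole.\<close>

lemma attains_min_at_right:
  fixes f :: "real \<Rightarrow> real"
  assumes "l < c" "continuous_on {l<..c} f" "filterlim f at_top (at_right l)"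
  obtains x where "l < x" "x \<le> c" "\<And>y. l < y \<Longrightarrow> y \<le> c \<Longrightarrow> f x \<le> f y"
proof -
  have "eventually (\<lambda>x. f c \<le> f x) (at_right l)"
    using assms(3) by (simp add: filterlim_at_top)
  then obtain d where d: "d > l" "\<And>y. l < y \<Longrightarrow> y < d \<Longrightarrow> f c \<le> f y"
    by (auto simp: eventually_at_right_field)
  define e where "e = min ((l + d) / 2) c"
  have e: "l < e" "e \<le> c" "e < d"
    using d assms(1) by (auto simp: e_def min_def)
  have "continuous_on {e..c} f"
    by (rule continuous_on_subset[OF assms(2)]) (use e in auto)
  then obtain x where x: "x \<in> {e..c}" "\<And>y. y \<in> {e..c} \<Longrightarrow> f x \<le> f y"
    using continuous_attains_inf[of "{e..c}" f] e by auto
  show ?thesis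
  proof (rule that[of x])
    show "f x \<le> f y" if "l < y" "y \<le> c" for y
      using x(2)[of y] x(2)[of c] d(2)[of y] that e by (cases "e \<le> y") auto
  qed (use x e in auto)
qed

lemma attains_min_at_left:
  fixes f :: "real \<Rightarrow> real"
  assumes "c < r" "continuous_on {c..<r} f" "filterlim f at_top (at_left r)"
  obtains x where "c \<le> x" "x < r" "\<And>y. c \<le> y \<Longrightarrow> y < r \<Longrightarrow> f x \<le> f y"
proof -
  have "continuous_on {-r<..-c} (\<lambda>x. f (-x))"
    by (rule continuous_on_compose2[OF assms(2)]) (auto intro!: continuous_intros)
  moreover have "filterlim (\<lambda>x. f (-x)) at_top (at_right (-r))"
    using assms(3) by (subst (asm) at_left_minus) (simp add: filterlim_filtermap)
  ultimately obtain x where "-r < x" "x \<le> -c" "\<And>y. -r < y \<Longrightarrow> y \<le> -c \<Longrightarrow> f (-x) \<le> f (-y)"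
    using attains_min_at_right[of "-r" "-c" "\<lambda>x. f (-x)"] assms(1) by auto
  note x = this(1,2) this(3)[of "-y" for y]
  show ?thesis
    by (rule that[of "-x"]) (use x in auto)
qed

text \<open>For each slope \<open>m\<close> compare the minima of \<open>G x - m * x\<close> to the left and to the right of
  \<open>x0\<close>; both are Lipschitz in \<open>m\<close>, and the intermediate value theorem makes them equal.\<close>

lemma supporting_line_two_contacts:
  fixes G :: "real \<Rightarrow> real"
  assumes x0: "l < x0" "x0 < r" and cont: "continuous_on {l<..<r} G"
    and lim_l: "filterlim G at_top (at_right l)" and lim_r: "filterlim G at_top (at_left r)"
  obtains A B m b where "l < A" "A \<le> x0" "x0 \<le> B" "B < r"
    "G A = m * A + b" "G B = m * B + b" "\<And>x. l < x \<Longrightarrow> x < r \<Longrightarrow> m * x + b \<le> G x"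
proof -
  have "\<exists>x. l < x \<and> x \<le> x0 \<and> (\<forall>y. l < y \<longrightarrow> y \<le> x0 \<longrightarrow> G x - m * x \<le> G y - m * y)" for m
  proof -
    have "continuous_on {l<..x0} (\<lambda>x. G x - m * x)"
      using x0 by (intro continuous_intros continuous_on_subset[OF cont]) auto
    moreover have "filterlim (\<lambda>x. - m * x + G x) at_top (at_right l)"
      by (rule filterlim_tendsto_add_at_top[OF _ lim_l]) (auto intro!: tendsto_eq_intros)
    ultimately show ?thesis
      using x0 attains_min_at_right[of l x0 "\<lambda>x. G x - m * x"] by auto
  qed
  then obtain \<alpha> where \<alpha>: "\<And>m. l < \<alpha> m" "\<And>m. \<alpha> m \<le> x0"
      "\<And>m y. l < y \<Longrightarrow> y \<le> x0 \<Longrightarrow> G (\<alpha> m) - m * \<alpha> m \<le> G y - m * y"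
    by metis
  have "\<exists>x. x0 \<le> x \<and> x < r \<and> (\<forall>y. x0 \<le> y \<longrightarrow> y < r \<longrightarrow> G x - m * x \<le> G y - m * y)" for m
  proof -
    have "continuous_on {x0..<r} (\<lambda>x. G x - m * x)"
      using x0 by (intro continuous_intros continuous_on_subset[OF cont]) auto
    moreover have "filterlim (\<lambda>x. - m * x + G x) at_top (at_left r)"
      by (rule filterlim_tendsto_add_at_top[OF _ lim_r]) (auto intro!: tendsto_eq_intros)
    ultimately show ?thesis
      using x0 attains_min_at_left[of x0 r "\<lambda>x. G x - m * x"] by auto
  qed
  then obtain \<beta> where \<beta>: "\<And>m. x0 \<le> \<beta> m" "\<And>m. \<beta> m < r"
      "\<And>m y. x0 \<le> y \<Longrightarrow> y < r \<Longrightarrow> G (\<beta> m) - m * \<beta> m \<le> G y - m * y"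
    by metis
  define L where "L m = G (\<alpha> m) - m * \<alpha> m" for m
  define R where "R m = G (\<beta> m) - m * \<beta> m" for m
  \<comment> \<open>\<open>K\<close> bounds all points of the interval, hence all minimisers, and
    becomes the Lipschitz constant of \<open>L\<close> and \<open>R\<close>.\<close>
  define K where "K = max \<bar>l\<bar> \<bar>r\<bar>"
  have K: "\<bar>x\<bar> \<le> K" if "l < x" "x < r" for x
    using that by (auto simp: K_def)
  have lipL: "L m' - L m \<le> K * \<bar>m' - m\<bar>" for m m'
  proof -
    \<comment> \<open>The minimiser for \<open>m\<close> is a competitor in the minimum for
      \<open>m'\<close>.\<close>
    have "L m' \<le> L m + (m - m') * \<alpha> m"
      using \<alpha>(3)[of "\<alpha> m" m'] \<alpha>(1,2)[of m] by (simp add: L_def algebra_simps)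
    also have "(m - m') * \<alpha> m \<le> \<bar>m - m'\<bar> * \<bar>\<alpha> m\<bar>"
      by (metis abs_ge_self abs_mult)
    also have "\<dots> \<le> \<bar>m - m'\<bar> * K"
      using K[of "\<alpha> m"] \<alpha>(1,2)[of m] x0 by (intro mult_left_mono) auto
    finally show ?thesis by (simp add: abs_minus_commute mult.commute)
  qed
  have lipR: "R m' - R m \<le> K * \<bar>m' - m\<bar>" for m m'
  proof -
    have "R m' \<le> R m + (m - m') * \<beta> m"
      using \<beta>(3)[of "\<beta> m" m'] \<beta>(1,2)[of m] by (simp add: R_def algebra_simps)
    also have "(m - m') * \<beta> m \<le> \<bar>m - m'\<bar> * \<bar>\<beta> m\<bar>"
      by (metis abs_ge_self abs_mult)
    also have "\<dots> \<le> \<bar>m - m'\<bar> * K"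
      using K[of "\<beta> m"] \<beta>(1,2)[of m] x0 by (intro mult_left_mono) auto
    finally show ?thesis by (simp add: abs_minus_commute mult.commute)
  qed
  have "K \<ge> 0" by (simp add: K_def)
  have "K-lipschitz_on UNIV L"
    by (rule lipschitz_onI[OF _ \<open>K \<ge> 0\<close>]) (smt (verit) lipL dist_real_def)
  moreover have "K-lipschitz_on UNIV R"
    by (rule lipschitz_onI[OF _ \<open>K \<ge> 0\<close>]) (smt (verit) lipR dist_real_def)
  ultimately have contLR: "continuous_on UNIV (\<lambda>m. L m - R m)"
    by (intro continuous_intros lipschitz_on_continuous_on)
  define x1 where "x1 = (l + x0) / 2"
  define x2 where "x2 = (x0 + r) / 2"
  have x12: "l < x1" "x1 < x0" "x0 < x2" "x2 < r"
    using x0 by (auto simp: x1_def x2_def)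
  \<comment> \<open>A slope so large that testing \<open>R mp\<close> at \<open>x2\<close> gives
    \<open>R mp <= L 0 - mp * x0\<close>; the right side is at most \<open>L mp\<close> because
    \<open>\<alpha> mp <= x0\<close> and \<open>mp >= 0\<close>.\<close>
  define mp where "mp = max 0 ((G x2 - L 0) / (x2 - x0))"
  have "mp * (x2 - x0) \<ge> G x2 - L 0"
  proof -
    have "(G x2 - L 0) / (x2 - x0) \<le> mp" by (simp add: mp_def)
    then show ?thesis using x12 by (simp add: divide_simps)
  qed
  moreover have "R mp \<le> G x2 - mp * x2"
    using \<beta>(3)[of x2 mp] x12 by (simp add: R_def)
  moreover have "L mp \<ge> L 0 - mp * x0"
  proof -
    have "mp * \<alpha> mp \<le> mp * x0"
      using \<alpha>(2)[of mp] by (intro mult_left_mono) (auto simp: mp_def)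
    moreover have "G (\<alpha> mp) \<ge> L 0"
      using \<alpha>(3)[of "\<alpha> mp" 0] \<alpha>(1,2)[of mp] by (simp add: L_def)
    ultimately show ?thesis by (simp add: L_def)
  qed
  ultimately have pos: "L mp - R mp \<ge> 0" by (simp add: algebra_simps)
  \<comment> \<open>Mirror image: testing \<open>L (-mn)\<close> at \<open>x1\<close> puts it below
    \<open>R 0 + mn * x0\<close>, which is a lower bound of \<open>R (-mn)\<close>.\<close>
  define mn where "mn = max 0 ((G x1 - R 0) / (x0 - x1))"
  have "mn * (x0 - x1) \<ge> G x1 - R 0"
  proof -
    have "(G x1 - R 0) / (x0 - x1) \<le> mn" by (simp add: mn_def)
    then show ?thesis using x12 by (simp add: divide_simps)
  qed
  moreover have "L (-mn) \<le> G x1 + mn * x1"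
    using \<alpha>(3)[of x1 "-mn"] x12 by (simp add: L_def)
  moreover have "R (-mn) \<ge> R 0 + mn * x0"
  proof -
    have "mn * \<beta> (-mn) \<ge> mn * x0"
      using \<beta>(1)[of "-mn"] by (intro mult_left_mono) (auto simp: mn_def)
    moreover have "G (\<beta> (-mn)) \<ge> R 0"
      using \<beta>(3)[of "\<beta> (-mn)" 0] \<beta>(1,2)[of "-mn"] by (simp add: R_def)
    ultimately show ?thesis by (simp add: R_def)
  qed
  ultimately have neg: "L (-mn) - R (-mn) \<le> 0" by (simp add: algebra_simps)
  have "- mn \<le> mp" by (simp add: mn_def mp_def)
  then obtain m where m: "L m - R m = 0"
    using IVT'[of "\<lambda>m. L m - R m" "-mn" 0 mp] neg pos continuous_on_subset[OF contLR]
    by blast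
  show ?thesis
  proof (rule that[of "\<alpha> m" "\<beta> m" m "L m"])
    show "m * x + L m \<le> G x" if "l < x" "x < r" for x
      using \<alpha>(3)[of x m] \<beta>(3)[of x m] that m by (cases "x \<le> x0") (auto simp: L_def R_def)
  qed (use \<alpha>(1,2) \<beta>(1,2) m in \<open>auto simp: L_def R_def\<close>)
qed

section \<open>Bitangent lines of a function whose second derivative changes sign at most once on
  each side of a point\<close>

text \<open>The difference of the two affine functions is monotone, so the inequality at one
  endpoint suffices; which one depends on the order of the slopes.\<close>

lemma affine_le_between:
  fixes m b m' b' :: real
  assumes "m * A + b \<le> m' * A + b'" "m * B + b \<le> m' * B + b'" "A \<le> x" "x \<le> B"
  shows "m * x + b \<le> m' * x + b'"
proof (cases "m \<le> m'")
  case True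
  then have "(m' - m) * A \<le> (m' - m) * x" using assms by (intro mult_left_mono) auto
  then show ?thesis using assms by (simp add: algebra_simps)
next
  case False
  then have "(m - m') * x \<le> (m - m') * B" using assms by (intro mult_left_mono) auto
  then show ?thesis using assms by (simp add: algebra_simps)
qed

text \<open>\<open>q\<close> is the second derivative of \<open>G\<close>. Only its sign is
  constrained: once nonnegative on one side of \<open>x0\<close>, it is positive further out.
  Monotonicity of \<open>q\<close> itself would be too much to ask, since dividing by the square of
  \<open>\<sigma>\<close> preserves signs but not monotonicity.\<close>

locale second_derivative_V_shaped =
  fixes G G' q :: "real \<Rightarrow> real" and l r x0 :: real
  assumes l_less: "l < x0" and less_r: "x0 < r"
    and deriv_G: "l < x \<Longrightarrow> x < r \<Longrightarrow> (G has_real_derivative G' x) (at x)"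
    and deriv_G': "l < x \<Longrightarrow> x < r \<Longrightarrow> (G' has_real_derivative q x) (at x)"
    and q_left: "l < x \<Longrightarrow> x < y \<Longrightarrow> y \<le> x0 \<Longrightarrow> 0 \<le> q y \<Longrightarrow> 0 < q x"
    and q_right: "x0 \<le> y \<Longrightarrow> y < x \<Longrightarrow> x < r \<Longrightarrow> 0 \<le> q y \<Longrightarrow> 0 < q x"
begin

lemma G'_less:
  assumes "l < u" "u < v" "v < r" "\<And>x. u < x \<Longrightarrow> x < v \<Longrightarrow> 0 < q x"
  shows "G' u < G' v"
proof (rule DERIV_pos_imp_increasing_open[OF \<open>u < v\<close>])
  show "\<exists>y. (G' has_real_derivative y) (at x) \<and> 0 < y" if "u < x" "x < v" for x
    using that assms deriv_G'[of x] by (intro exI[of _ "q x"]) auto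
  show "continuous_on {u..v} G'"
    by (rule DERIV_continuous_on[of _ _ q])
      (use assms deriv_G' in \<open>auto intro: has_field_derivative_at_within\<close>)
qed

lemma G'_less_left:
  assumes "l < u" "u < v" "v \<le> x0" "0 \<le> q v"
  shows "G' u < G' v"
  by (rule G'_less) (use assms less_r q_left[of _ v] in auto)

lemma G'_less_right:
  assumes "x0 \<le> u" "u < v" "v < r" "0 \<le> q u"
  shows "G' u < G' v"
  by (rule G'_less) (use assms l_less q_right[of u] in auto)

text \<open>This excludes bitangents in the degenerate case. As \<open>q x0\<close> may vanish,
  \<open>q\<close> is known to be positive only off \<open>x0\<close>, and an interval with
  \<open>x0\<close> in its interior is split there.\<close>

lemma G'_less_of_nonneg:
  assumes "l < u" "u < v" "v < r" "0 \<le> q x0"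
  shows "G' u < G' v"
proof -
  have q: "0 < q x" if "l < x" "x < r" "x \<noteq> x0" for x
    using that assms(4) q_left[of x x0] q_right[of x0 x] by (cases "x < x0") auto
  show ?thesis
  proof (cases "u < x0 \<and> x0 < v")
    case True
    have "G' u < G' x0"
      by (rule G'_less) (use True assms in \<open>auto intro!: q\<close>)
    also have "G' x0 < G' v"
      by (rule G'_less) (use True assms in \<open>auto intro!: q\<close>)
    finally show ?thesis .
  next
    case False
    show ?thesis
      by (rule G'_less) (use False assms in \<open>auto intro!: q\<close>)
  qed
qed

text \<open>The line is required to lie below \<open>G\<close> only between the contacts, which is
  all that the boundary problem provides; the bound on the whole interval is
  \<open>bitangent_below\<close>.\<close>

definition bitangent :: "real \<Rightarrow> real \<Rightarrow> real \<Rightarrow> real \<Rightarrow> bool" where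
  "bitangent A B m b \<longleftrightarrow> l < A \<and> A < B \<and> B < r \<and>
     G A = m * A + b \<and> G B = m * B + b \<and> G' A = m \<and> G' B = m \<and>
     (\<forall>x\<in>{A<..<B}. m * x + b < G x)"

text \<open>The gap between \<open>G\<close> and the line has a one-sided minimum with zero slope at
  each contact, which gives the sign of \<open>q\<close>. If \<open>A\<close> were at least
  \<open>x0\<close>, then \<open>G'\<close> would increase strictly from \<open>A\<close> to
  \<open>B\<close>, against the equal slopes; \<open>B\<close> is treated likewise.\<close>

lemma bitangent_contact:
  assumes "bitangent A B m b" "q x0 < 0"
  shows "A < x0" "x0 < B" "0 \<le> q A" "0 \<le> q B"
proof -
  have AB: "l < A" "A < B" "B < r" "G A = m * A + b" "G B = m * B + b" "G' A = m" "G' B = m"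
    and above: "\<And>x. A < x \<Longrightarrow> x < B \<Longrightarrow> m * x + b < G x"
    using assms(1) by (auto simp: bitangent_def)
  let ?w = "\<lambda>x. G x - (m * x + b)"
  have w: "(?w has_real_derivative G' x - m) (at x)" if "l < x" "x < r" for x
    using deriv_G[OF that] by (auto intro!: derivative_eq_intros)
  have w': "((\<lambda>x. G' x - m) has_real_derivative q x) (at x)" if "l < x" "x < r" for x
    using deriv_G'[OF that] by (auto intro!: derivative_eq_intros)
  show qA: "0 \<le> q A"
    by (rule DERIV_nonneg_at_right_min[OF \<open>A < B\<close> w w'])
      (use AB above in \<open>auto intro: less_imp_le\<close>)
  show qB: "0 \<le> q B"
    by (rule DERIV_nonneg_at_left_min[OF \<open>A < B\<close> w w'])
      (use AB above in \<open>auto intro: less_imp_le\<close>)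
  show "A < x0"
    using G'_less_right[of A B] AB qA by fastforce
  show "x0 < B"
    using G'_less_left[of A B] AB qB by fastforce
qed

text \<open>Since \<open>q\<close> is nonnegative at the contacts, it is positive beyond them, so
  the slope of \<open>G\<close> is below \<open>m\<close> left of \<open>A\<close> and above
  \<open>m\<close> right of \<open>B\<close>.\<close>

lemma bitangent_below:
  assumes "bitangent A B m b" "q x0 < 0" "l < x" "x < r" "x \<noteq> A" "x \<noteq> B"
  shows "m * x + b < G x"
proof -
  have AB: "l < A" "A < B" "B < r" "G A = m * A + b" "G B = m * B + b" "G' A = m" "G' B = m"
    and above: "\<And>x. A < x \<Longrightarrow> x < B \<Longrightarrow> m * x + b < G x"
    using assms(1) by (auto simp: bitangent_def)
  note contact = bitangent_contact[OF assms(1,2)]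
  consider "x < A" | "A < x" "x < B" | "B < x" using assms by linarith
  then show ?thesis
  proof cases
    case 1
    obtain z where z: "x < z" "z < A" "G A - G x = (A - x) * G' z"
      using MVT2[of x A G G'] deriv_G 1 assms AB by force
    have "G' z < m"
      using G'_less_left[of z A] contact z AB assms by simp
    then have "(A - x) * G' z < (A - x) * m" using 1 by simp
    then show ?thesis using z(3) AB by (simp add: algebra_simps)
  next
    case 2
    then show ?thesis by (rule above)
  next
    case 3
    obtain z where z: "B < z" "z < x" "G x - G B = (x - B) * G' z"
      using MVT2[of B x G G'] deriv_G 3 assms AB by force
    have "G' z > m"
      using G'_less_right[of B z] contact z AB assms by simp
    then have "(x - B) * G' z > (x - B) * m" using 3 by simp
    then show ?thesis using z(3) AB by (simp add: algebra_simps)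
  qed
qed

text \<open>Each line is below \<open>G\<close>, hence below the other line at the contacts of the
  other. Both contact intervals contain \<open>x0\<close>, so the lines agree at \<open>x0\<close>.
  The second does not exceed the first at \<open>A\<close> and \<open>B\<close>, on either side of
  \<open>x0\<close>, so the slopes agree too. The contacts then coincide because the line is
  strictly below \<open>G\<close> elsewhere.\<close>

lemma bitangent_unique:
  assumes AB: "bitangent A B m b" and AB': "bitangent A' B' m' b'" and neg: "q x0 < 0"
  shows "A' = A \<and> B' = B \<and> m' = m \<and> b' = b"
proof -
  have le: "m * x + b \<le> G x" if "l < x" "x < r" for x
    using bitangent_below[OF AB neg that] AB by (force simp: bitangent_def)
  have le': "m' * x + b' \<le> G x" if "l < x" "x < r" for x
    using bitangent_below[OF AB' neg that] AB' by (force simp: bitangent_def)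
  note c = bitangent_contact[OF AB neg] and c' = bitangent_contact[OF AB' neg]
  have A: "m' * A + b' \<le> m * A + b" and B: "m' * B + b' \<le> m * B + b"
    using le'[of A] le'[of B] AB by (auto simp: bitangent_def)
  have A': "m * A' + b \<le> m' * A' + b'" and B': "m * B' + b \<le> m' * B' + b'"
    using le[of A'] le[of B'] AB' by (auto simp: bitangent_def)
  have eq: "m * x0 + b = m' * x0 + b'"
    using affine_le_between[OF A B, of x0] affine_le_between[OF A' B', of x0] c c' by simp
  have "(m' - m) * (A - x0) \<le> 0" "(m' - m) * (B - x0) \<le> 0"
    using A B eq by (simp_all add: algebra_simps)
  then have m: "m' = m"
    using c by (smt (verit) mult_pos_pos mult_neg_neg)
  then have b: "b' = b" using eq by simp
  have "A' = A \<or> A' = B" "B' = A \<or> B' = B"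
    using bitangent_below[OF AB neg, of A'] bitangent_below[OF AB neg, of B'] AB' m b
    by (auto simp: bitangent_def)
  with c c' m b show ?thesis by auto
qed

text \<open>The contacts of the supporting line are minima of the gap, so the line is tangent there
  and \<open>q\<close> is nonnegative. Hence neither contact is \<open>x0\<close>, and the two are
  distinct.\<close>

lemma bitangent_exists:
  assumes neg: "q x0 < 0"
    and "filterlim G at_top (at_right l)" "filterlim G at_top (at_left r)"
  obtains A B m b where "bitangent A B m b"
proof -
  have "continuous_on {l<..<r} G"
    by (rule DERIV_continuous_on[of _ _ G'])
      (use deriv_G in \<open>auto intro: has_field_derivative_at_within\<close>)
  then obtain A B m b where AB: "l < A" "A \<le> x0" "x0 \<le> B" "B < r"
      "G A = m * A + b" "G B = m * B + b"
    and le: "\<And>x. l < x \<Longrightarrow> x < r \<Longrightarrow> m * x + b \<le> G x"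
    using supporting_line_two_contacts[OF l_less less_r _ assms(2,3)] by metis
  let ?w = "\<lambda>x. G x - (m * x + b)"
  have w: "(?w has_real_derivative G' x - m) (at x)" if "l < x" "x < r" for x
    using deriv_G[OF that] by (auto intro!: derivative_eq_intros)
  have w': "((\<lambda>x. G' x - m) has_real_derivative q x) (at x)" if "l < x" "x < r" for x
    using deriv_G'[OF that] by (auto intro!: derivative_eq_intros)
  have slope: "G' x = m" if "l < x" "x < r" "G x = m * x + b" for x
  proof -
    have "G' x - m = 0"
      by (rule DERIV_local_min[OF w, of x "min (x - l) (r - x)"]) (use that le in \<open>auto simp: abs_if split: if_splits\<close>)
    then show ?thesis by simp
  qed
  have q: "0 \<le> q x" if "l < x" "x < r" "G x = m * x + b" for x
    by (rule DERIV_nonneg_at_right_min[OF \<open>x < r\<close> w w']) (use that le slope in auto)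
  have "A \<noteq> x0" "x0 \<noteq> B" using q[of A] q[of B] AB neg l_less less_r by auto
  have "bitangent A B m b"
    unfolding bitangent_def
  proof (intro conjI ballI)
    fix x assume x: "x \<in> {A<..<B}"
    \<comment> \<open>An interior contact would again have slope \<open>m\<close> and nonnegative
      \<open>q\<close>, so \<open>G'\<close> would increase strictly between it and
      \<open>A\<close>, or decrease strictly between \<open>B\<close> and it, depending on its side
      of \<open>x0\<close>.\<close>
    have "G x \<noteq> m * x + b"
    proof
      assume eq: "G x = m * x + b"
      have "G' x = m" "0 \<le> q x" using slope q eq x AB by auto
      then show False
        using G'_less_left[of A x] G'_less_right[of x B] slope[of A] slope[of B] x AB
          l_less less_r by (cases "x \<le> x0") auto
    qed
    then show "m * x + b < G x" using le[of x] x AB by force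
  qed (use AB slope \<open>A \<noteq> x0\<close> \<open>x0 \<noteq> B\<close> l_less less_r in auto)
  then show ?thesis by (rule that)
qed

end

section \<open>Gluing derivatives, and continuous differentiability on open sets\<close>

text \<open>At every \<open>y\<close> the difference quotient of the glued function is one of two
  quotients that both tend to \<open>d\<close>, so \<open>P\<close> may be arbitrary.\<close>

lemma has_real_derivative_If_agree:
  fixes f g :: "real \<Rightarrow> real"
  assumes "(f has_real_derivative d) (at a)" "(g has_real_derivative d) (at a)" "f a = g a"
  shows "((\<lambda>x. if P x then f x else g x) has_real_derivative d) (at a)"
proof -
  have "((\<lambda>y. if P y then (f y - f a) / (y - a) else (g y - g a) / (y - a)) \<longlongrightarrow> d) (at a)"
    by (rule filterlim_If) (use assms in \<open>auto simp: has_field_derivative_iff intro: tendsto_mono[OF inf_le1]\<close>)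
  moreover have "(\<lambda>y. if P y then (f y - f a) / (y - a) else (g y - g a) / (y - a)) =
      (\<lambda>y. ((if P y then f y else g y) - (if P a then f a else g a)) / (y - a))"
    using assms(3) by auto
  ultimately show ?thesis by (simp add: has_field_derivative_iff)
qed

lemma C1_differentiable_onI:
  fixes f f' :: "real \<Rightarrow> real"
  assumes "\<And>x. x \<in> S \<Longrightarrow> (f has_real_derivative f' x) (at x)" "continuous_on S f'"
  shows "f C1_differentiable_on S"
  using assms by (auto simp: C1_differentiable_on_def has_real_derivative_iff_has_vector_derivative)

lemma C1_differentiable_on_iff_deriv:
  fixes f :: "real \<Rightarrow> real"
  shows "f C1_differentiable_on S \<longleftrightarrow>
    (\<forall>x\<in>S. (f has_real_derivative deriv f x) (at x)) \<and> continuous_on S (deriv f)"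
  unfolding C1_differentiable_on_eq field_derivative_eq_vector_derivative[symmetric]
  by (auto simp: DERIV_deriv_iff_real_differentiable)

lemma has_real_derivative_deriv_cong:
  fixes f f' :: "real \<Rightarrow> real"
  assumes "open S" "\<And>x. x \<in> S \<Longrightarrow> (f has_real_derivative f' x) (at x)"
    and "(f' has_real_derivative d) (at a)" "a \<in> S"
  shows "(deriv f has_real_derivative d) (at a)"
  by (rule has_field_derivative_transform_within_open[OF assms(3,1,4)])
    (use assms(2) in \<open>auto intro: DERIV_imp_deriv[symmetric]\<close>)

lemma C2_onI:
  assumes "open S" and f: "\<And>x. x \<in> S \<Longrightarrow> (f has_real_derivative f' x) (at x)"
    and f': "\<And>x. x \<in> S \<Longrightarrow> (f' has_real_derivative f'' x) (at x)"
    and "continuous_on S f''"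
  shows "C2_on f S"
  unfolding C2_on_def
proof
  have "continuous_on S f'"
    by (rule DERIV_continuous_on[of _ _ f'']) (auto intro: has_field_derivative_at_within f')
  then show "f C1_differentiable_on S" using f by (rule C1_differentiable_onI[rotated])
  show "deriv f C1_differentiable_on S"
    using has_real_derivative_deriv_cong[OF assms(1) f f'] assms(4)
    by (rule C1_differentiable_onI)
qed

lemma C2_onD:
  assumes "C2_on f S" "x \<in> S"
  shows "(f has_real_derivative deriv f x) (at x)"
    "(deriv f has_real_derivative deriv (deriv f) x) (at x)"
  using assms by (auto simp: C2_on_def C1_differentiable_on_iff_deriv)

lemma C2_on_Un:
  assumes "open S" "open T" "C2_on f S" "C2_on f T"
  shows "C2_on f (S \<union> T)"
  using assms by (auto simp: C2_on_def C1_differentiable_on_iff_deriv intro: continuous_on_open_Un)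

lemma has_real_derivative_interval_integral:
  fixes s :: "real \<Rightarrow> real"
  assumes "continuous_on {l<..<r} s" "l < a" "a < r" "l < x" "x < r"
  shows "((\<lambda>u. LBINT z=ereal a..ereal u. s z) has_real_derivative s x) (at x)"
proof -
  \<comment> \<open>The fundamental theorem is applied on \<open>{d..e}\<close>, a compact
    subinterval containing \<open>a\<close> and having \<open>x\<close> in its interior, so that the
    derivative within it is the full one.\<close>
  define d where "d = (l + min a x) / 2"
  define e where "e = (max a x + r) / 2"
  have de: "l < d" "d < a" "d < x" "a < e" "x < e" "e < r"
    using assms by (auto simp: d_def e_def min_def max_def)
  have "((\<lambda>u. LBINT z=ereal a..ereal u. s z) has_vector_derivative s x) (at x within {d..e})"
    by (rule interval_integral_FTC2) (use de in \<open>auto intro: continuous_on_subset[OF assms(1)]\<close>)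
  moreover have "at x within {d..e} = at x"
    using de by (intro at_within_interior) auto
  ultimately show ?thesis
    by (simp add: has_real_derivative_iff_has_vector_derivative)
qed

section \<open>The function \<open>G\<close> of the stopping problem and the sign of its second
  derivative\<close>

locale stopping_problem =
  fixes \<sigma> g :: "real \<Rightarrow> real" and c x0 :: real
  assumes c_pos: "0 < c"
    and diffusion: "diffusion_condition \<sigma>"
    and obstacle: "obstacle_condition g"
    and unimodal: "unimodal_condition \<sigma> g x0"
begin

text \<open>\<open>p\<close> and \<open>P\<close> are the inner and the outer integral of the
  divergence condition in \<open>diffusion_condition\<close>, with base point
  \<open>a = x0\<close>.\<close>

definition p :: "real \<Rightarrow> real" where
  "p x = (LBINT z=ereal x0..ereal x. 1 / (\<sigma> z)\<^sup>2)"

definition P :: "real \<Rightarrow> real" where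
  "P x = (LBINT y=ereal x0..ereal x. p y)"

definition G :: "real \<Rightarrow> real" where "G x = g x + 2 * c * P x"

definition G' :: "real \<Rightarrow> real" where "G' x = deriv g x + 2 * c * p x"

definition q :: "real \<Rightarrow> real" where "q x = deriv (deriv g) x + 2 * c / (\<sigma> x)\<^sup>2"

lemma x0: "0 < x0" "x0 < 1"
  using unimodal by (auto simp: unimodal_condition_def)

lemma sigma_nonzero: "0 < x \<Longrightarrow> x < 1 \<Longrightarrow> \<sigma> x \<noteq> 0"
  using diffusion by (auto simp: diffusion_condition_def)

lemma continuous_sigma: "continuous_on {0<..<1} \<sigma>"
  using diffusion by (auto simp: diffusion_condition_def intro: continuous_on_subset)

lemma continuous_speed: "continuous_on {0<..<1} (\<lambda>x. 1 / (\<sigma> x)\<^sup>2)"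
  using continuous_sigma sigma_nonzero by (intro continuous_intros) auto

lemma C2_g: "C2_on g {0<..<1}"
  using obstacle by (simp add: obstacle_condition_def)

lemma deriv_p: "0 < x \<Longrightarrow> x < 1 \<Longrightarrow> (p has_real_derivative 1 / (\<sigma> x)\<^sup>2) (at x)"
  using has_real_derivative_interval_integral[OF continuous_speed, of x0 x] x0
  by (simp add: p_def[abs_def])

lemma continuous_p: "continuous_on {0<..<1} p"
  by (rule DERIV_continuous_on[of _ _ "\<lambda>x. 1 / (\<sigma> x)\<^sup>2"])
    (auto intro: has_field_derivative_at_within deriv_p)

lemma deriv_P: "0 < x \<Longrightarrow> x < 1 \<Longrightarrow> (P has_real_derivative p x) (at x)"
  using has_real_derivative_interval_integral[OF continuous_p, of x0 x] x0
  by (simp add: P_def[abs_def])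

lemma P_at_top: "filterlim P at_top (at_right 0)" "filterlim P at_top (at_left 1)"
  using diffusion x0 by (auto simp: diffusion_condition_def P_def[abs_def] p_def[abs_def])

lemma deriv_G: "0 < x \<Longrightarrow> x < 1 \<Longrightarrow> (G has_real_derivative G' x) (at x)"
  unfolding G_def[abs_def] G'_def
  by (auto intro!: derivative_eq_intros C2_onD[OF C2_g] deriv_P)

lemma deriv_G': "0 < x \<Longrightarrow> x < 1 \<Longrightarrow> (G' has_real_derivative q x) (at x)"
  unfolding G'_def[abs_def] q_def
  by (auto intro!: derivative_eq_intros C2_onD[OF C2_g] deriv_p)

lemma q_eq: "0 < x \<Longrightarrow> x < 1 \<Longrightarrow> q x = 2 / (\<sigma> x)\<^sup>2 * (generator \<sigma> g x + c)"
  using sigma_nonzero[of x] by (simp add: q_def generator_def field_simps)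

lemma q_sign:
  assumes "0 < x" "x < 1"
  shows "0 < q x \<longleftrightarrow> - c < generator \<sigma> g x" "0 \<le> q x \<longleftrightarrow> - c \<le> generator \<sigma> g x"
proof -
  have pos: "0 < 2 / (\<sigma> x)\<^sup>2" using sigma_nonzero[OF assms] by simp
  show "0 < q x \<longleftrightarrow> - c < generator \<sigma> g x"
    unfolding q_eq[OF assms] using zero_less_mult_iff[of "2 / (\<sigma> x)\<^sup>2"] pos by smt
  show "0 \<le> q x \<longleftrightarrow> - c \<le> generator \<sigma> g x"
    unfolding q_eq[OF assms] using zero_le_mult_iff[of "2 / (\<sigma> x)\<^sup>2"] pos by smt
qed

lemma isCont_generator: "isCont (generator \<sigma> g) x0"
proof -
  have "continuous_on {0<..<1} (generator \<sigma> g)"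
    using C2_g unfolding generator_def[abs_def] C2_on_def C1_differentiable_on_iff_deriv
    by (intro continuous_intros continuous_sigma) auto
  then show ?thesis using x0 by (simp add: continuous_on_eq_continuous_at)
qed

text \<open>\<open>unimodal_condition\<close> concerns open intervals only; the value at
  \<open>x0\<close> is reached by continuity, with an intermediate point \<open>z\<close> that keeps
  the inequality strict.\<close>

lemma generator_less_left:
  assumes "0 < x" "x < y" "y \<le> x0"
  shows "generator \<sigma> g y < generator \<sigma> g x"
proof (cases "y = x0")
  case False
  then show ?thesis
    using unimodal assms by (auto simp: unimodal_condition_def monotone_on_def)
next
  case True
  define z where "z = (x + x0) / 2"
  have z: "x < z" "z < x0" using assms True by (auto simp: z_def)
  have "generator \<sigma> g x0 \<le> generator \<sigma> g z"
  proof (rule tendsto_upperbound)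
    show "(generator \<sigma> g \<longlongrightarrow> generator \<sigma> g x0) (at_left x0)"
      using isCont_generator by (simp add: isCont_def filterlim_at_split)
    have "eventually (\<lambda>t. t \<in> {z<..<x0}) (at_left x0)"
      by (rule eventually_at_leftI[OF _ z(2)])
    then show "eventually (\<lambda>t. generator \<sigma> g t \<le> generator \<sigma> g z) (at_left x0)"
    proof eventually_elim
      case (elim t)
      then have "generator \<sigma> g t < generator \<sigma> g z"
        using unimodal z assms by (auto simp: unimodal_condition_def monotone_on_def)
      then show ?case by simp
    qed
  qed simp
  also have "generator \<sigma> g z < generator \<sigma> g x"
    using unimodal z assms by (auto simp: unimodal_condition_def monotone_on_def)
  finally show ?thesis using True by simp
qed

lemma generator_less_right:
  assumes "x0 \<le> y" "y < x" "x < 1"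
  shows "generator \<sigma> g y < generator \<sigma> g x"
proof (cases "y = x0")
  case False
  then show ?thesis
    using unimodal assms by (auto simp: unimodal_condition_def monotone_on_def)
next
  case True
  define z where "z = (x + x0) / 2"
  have z: "x0 < z" "z < x" using assms True by (auto simp: z_def)
  have "generator \<sigma> g x0 \<le> generator \<sigma> g z"
  proof (rule tendsto_upperbound)
    show "(generator \<sigma> g \<longlongrightarrow> generator \<sigma> g x0) (at_right x0)"
      using isCont_generator by (simp add: isCont_def filterlim_at_split)
    have "eventually (\<lambda>t. t \<in> {x0<..<z}) (at_right x0)"
      by (rule eventually_at_rightI[OF _ z(1)])
    then show "eventually (\<lambda>t. generator \<sigma> g t \<le> generator \<sigma> g z) (at_right x0)"
    proof eventually_elim
      case (elim t)
      then have "generator \<sigma> g t < generator \<sigma> g z"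
        using unimodal z assms by (auto simp: unimodal_condition_def monotone_on_def)
      then show ?case by simp
    qed
  qed simp
  also have "generator \<sigma> g z < generator \<sigma> g x"
    using unimodal z assms by (auto simp: unimodal_condition_def monotone_on_def)
  finally show ?thesis using True by simp
qed

text \<open>By \<open>q_sign\<close> the conditions on \<open>q\<close> compare the generator with
  \<open>- c\<close>, and the generator increases strictly away from \<open>x0\<close>.\<close>

sublocale shape: second_derivative_V_shaped G G' q 0 1 x0
proof
  show "0 < q x" if "0 < x" "x < y" "y \<le> x0" "0 \<le> q y" for x y
    using that generator_less_left[of x y] q_sign[of x] q_sign[of y] x0 by simp
  show "0 < q x" if "x0 \<le> y" "y < x" "x < 1" "0 \<le> q y" for x y
    using that generator_less_right[of y x] q_sign[of x] q_sign[of y] x0 by simp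
qed (use x0 deriv_G deriv_G' in auto)

text \<open>\<open>g\<close> is nonnegative on the unit interval, so \<open>G\<close> dominates
  \<open>2 * c * P\<close>.\<close>

lemma G_at_top:
  assumes "filterlim P at_top F" "eventually (\<lambda>x. x \<in> {0..1}) F"
  shows "filterlim G at_top F"
proof (rule filterlim_at_top_mono)
  show "filterlim (\<lambda>x. 2 * c * P x) at_top F"
    using c_pos by (intro filterlim_tendsto_pos_mult_at_top[OF tendsto_const _ assms(1)]) auto
  show "eventually (\<lambda>x. 2 * c * P x \<le> G x) F"
    using assms(2) by eventually_elim
      (use obstacle in \<open>auto simp: G_def obstacle_condition_def\<close>)
qed

section \<open>Correspondence between solutions of the boundary problem and bitangents of
  \<open>G\<close>\<close>

text \<open>\<open>V + 2 * c * P\<close> has zero second derivative inside the interval and is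
  continuous up to its ends. No sign of \<open>q\<close> enters, so the result serves both cases of
  the theorem.\<close>

lemma equations_imp_affine:
  assumes eqs: "free_boundary_equations \<sigma> g c A B V" and AB: "0 < A" "A < B" "B < 1"
  obtains m b where "\<And>x. A \<le> x \<Longrightarrow> x \<le> B \<Longrightarrow> V x = m * x + b - 2 * c * P x"
    "G' A = m" "G' B = m"
proof -
  define F where "F x = V x + 2 * c * P x" for x
  have V: "(V has_real_derivative deriv V x) (at x)" if "A \<le> x" "x \<le> B" for x
    using eqs that by (cases "x = A \<or> x = B")
      (auto simp: free_boundary_equations_def DERIV_deriv_iff_real_differentiable)
  have F: "(F has_real_derivative deriv V x + 2 * c * p x) (at x)" if "A \<le> x" "x \<le> B" for x
    using V[OF that] deriv_P[of x] that AB unfolding F_def[abs_def]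
    by (auto intro!: derivative_eq_intros)
  have F': "((\<lambda>x. deriv V x + 2 * c * p x) has_real_derivative 0) (at x)" if "A < x" "x < B" for x
  proof -
    have "(deriv V has_real_derivative deriv (deriv V) x) (at x)"
      using eqs that by (auto simp: free_boundary_equations_def DERIV_deriv_iff_real_differentiable)
    moreover have "deriv (deriv V) x = - 2 * c * (1 / (\<sigma> x)\<^sup>2)"
      using eqs that AB sigma_nonzero[of x]
      by (auto simp: free_boundary_equations_def generator_def field_simps)
    ultimately show ?thesis
      using deriv_p[of x] that AB by (auto intro!: derivative_eq_intros)
  qed
  have "\<exists>m. \<forall>x\<in>{A<..<B}. deriv V x + 2 * c * p x = m"
    by (rule has_field_derivative_zero_constant) (auto intro: has_field_derivative_at_within F')
  then obtain m where m: "\<And>x. A < x \<Longrightarrow> x < B \<Longrightarrow> deriv V x + 2 * c * p x = m"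
    by auto
  define b where "b = F A - m * A"
  have line: "F x = m * x + b" if "A \<le> x" "x \<le> B" for x
  proof -
    have "F x - m * x = F A - m * A"
    proof (rule DERIV_isconst2[OF \<open>A < B\<close>])
      show "continuous_on {A..B} (\<lambda>x. F x - m * x)"
        by (intro continuous_intros DERIV_continuous_on[of _ _ "\<lambda>x. deriv V x + 2 * c * p x"])
          (auto intro: has_field_derivative_at_within F)
      show "((\<lambda>x. F x - m * x) has_real_derivative 0) (at x)" if "A < x" "x < B" for x
        using F[of x] m[of x] that by (auto intro!: derivative_eq_intros)
    qed (use that in auto)
    then show ?thesis by (simp add: b_def)
  qed
  \<comment> \<open>At the ends \<open>F\<close> is known to be affine only on the side of the
    interval. Uniqueness of the derivative within the closed interval equates that slope with the
    full derivative, which the boundary condition turns into \<open>G' x\<close>.\<close>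
  have "G' x = m" if x: "x \<in> {A, B}" for x
  proof -
    have "deriv V x = deriv g x" using eqs x by (auto simp: free_boundary_equations_def)
    then have "(F has_vector_derivative G' x) (at x within cbox A B)"
      using F[of x] x AB
      by (auto simp: G'_def has_real_derivative_iff_has_vector_derivative
          intro: has_vector_derivative_at_within)
    moreover have "((\<lambda>x. m * x + b) has_vector_derivative m) (at x within cbox A B)"
      unfolding has_real_derivative_iff_has_vector_derivative[symmetric]
      by (auto intro!: derivative_eq_intros)
    then have "(F has_vector_derivative m) (at x within cbox A B)"
      by (rule has_vector_derivative_transform[rotated 2]) (use x AB line in auto)
    ultimately show ?thesis
      using vector_derivative_unique_within_closed_interval[OF \<open>A < B\<close>, of x F "G' x" m] x AB by auto
  qed
  then show ?thesis
    using that[of m b] line by (auto simp: F_def algebra_simps)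
qed

lemma solution_imp_bitangent:
  assumes "free_boundary_solution \<sigma> g c A B V"
  obtains m b where "shape.bitangent A B m b"
    "\<And>x. A \<le> x \<Longrightarrow> x \<le> B \<Longrightarrow> V x = m * x + b - 2 * c * P x"
proof -
  have eqs: "free_boundary_equations \<sigma> g c A B V" and AB: "0 < A" "A < B" "B < 1"
    using assms by (auto simp: free_boundary_solution_def)
  obtain m b where line: "\<And>x. A \<le> x \<Longrightarrow> x \<le> B \<Longrightarrow> V x = m * x + b - 2 * c * P x"
    and slope: "G' A = m" "G' B = m"
    using equations_imp_affine[OF eqs AB] by metis
  have V: "V A = g A" "V B = g B" "\<And>x. A < x \<Longrightarrow> x < B \<Longrightarrow> V x < g x"
    using eqs by (auto simp: free_boundary_equations_def)
  have "shape.bitangent A B m b"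
    unfolding shape.bitangent_def
    using AB slope V line[of A] line[of B] line
    by (force simp: G_def)
  then show ?thesis using line by (rule that)
qed

text \<open>After \<open>2 * c * P\<close> is subtracted, contact of the line with \<open>G\<close>
  becomes equality with \<open>g\<close>, and tangency becomes equality of derivatives, so the
  pieces match to first order at \<open>A\<close> and \<open>B\<close>.\<close>

lemma bitangent_imp_solution:
  assumes "shape.bitangent A B m b"
  shows "regular_solution \<sigma> g c A B (\<lambda>x. if A < x \<and> x < B then m * x + b - 2 * c * P x else g x)"
proof -
  have AB: "0 < A" "A < B" "B < 1" "G A = m * A + b" "G B = m * B + b" "G' A = m" "G' B = m"
    and above: "\<And>x. A < x \<Longrightarrow> x < B \<Longrightarrow> m * x + b < G x"
    using assms by (auto simp: shape.bitangent_def)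
  define U where "U x = m * x + b - 2 * c * P x" for x
  define V where "V x = (if A < x \<and> x < B then U x else g x)" for x
  define D where "D x = (if A < x \<and> x < B then m - 2 * c * p x else deriv g x)" for x
  have U: "(U has_real_derivative m - 2 * c * p x) (at x)" if "0 < x" "x < 1" for x
    unfolding U_def[abs_def] using deriv_P[OF that] by (auto intro!: derivative_eq_intros)
  have U': "((\<lambda>x. m - 2 * c * p x) has_real_derivative - 2 * c * (1 / (\<sigma> x)\<^sup>2)) (at x)"
    if "0 < x" "x < 1" for x
    using deriv_p[OF that] by (auto intro!: derivative_eq_intros)
  note g = C2_onD(1)[OF C2_g] and g' = C2_onD(2)[OF C2_g]
  have V_in: "(V has_real_derivative m - 2 * c * p x) (at x)" if "A < x" "x < B" for x
    by (rule has_field_derivative_transform_within_open[OF U, of x "{A<..<B}"])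
      (use that AB in \<open>auto simp: V_def\<close>)
  have V_out: "(V has_real_derivative deriv g x) (at x)" if "x \<in> {0<..<A} \<union> {B<..<1}" for x
    by (rule has_field_derivative_transform_within_open[OF g, of x "{0<..<A} \<union> {B<..<1}"])
      (use that AB in \<open>auto simp: V_def\<close>)
  have V_bd: "(V has_real_derivative deriv g x) (at x)" if "x \<in> {A, B}" for x
  proof -
    have "m - 2 * c * p x = deriv g x" "U x = g x"
      using AB that by (auto simp: G_def G'_def U_def)
    then have "(U has_real_derivative deriv g x) (at x)" "U x = g x"
      using U[of x] AB that by auto
    then show ?thesis
      unfolding V_def[abs_def] using g[of x] that AB by (intro has_real_derivative_If_agree) auto
  qed
  have D: "(V has_real_derivative D x) (at x)" if "x \<in> {0<..<1}" for x
  proof -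
    consider "A < x" "x < B" | "x \<in> {0<..<A} \<union> {B<..<1}" | "x \<in> {A, B}"
      using \<open>x \<in> {0<..<1}\<close> by force
    then show ?thesis
      using V_in[of x] V_out[of x] V_bd[of x] AB by cases (auto simp: D_def)
  qed
  \<comment> \<open>Second-order regularity is checked on the inner and the outer open set
    separately, as the second derivative may jump at \<open>A\<close> and \<open>B\<close>.\<close>
  have C2_in: "C2_on V {A<..<B}"
  proof (rule C2_onI[OF _ V_in U'])
    have "continuous_on {A<..<B} (\<lambda>x. 1 / (\<sigma> x)\<^sup>2)"
      by (rule continuous_on_subset[OF continuous_speed]) (use AB in auto)
    then show "continuous_on {A<..<B} (\<lambda>x. - 2 * c * (1 / (\<sigma> x)\<^sup>2))"
      by (rule continuous_on_mult_left)
  qed (use AB in auto)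
  have C2_out: "C2_on V ({0<..<A} \<union> {B<..<1})"
  proof (rule C2_onI[OF _ V_out g'])
    have "continuous_on {0<..<1} (deriv (deriv g))"
      using C2_g by (simp add: C2_on_def C1_differentiable_on_iff_deriv)
    then show "continuous_on ({0<..<A} \<union> {B<..<1}) (deriv (deriv g))"
      by (rule continuous_on_subset) (use AB in auto)
  qed (use AB in auto)
  have "C2_on V ({A<..<B} \<union> ({0<..<A} \<union> {B<..<1}))"
    by (rule C2_on_Un) (use C2_in C2_out in auto)
  also have "{A<..<B} \<union> ({0<..<A} \<union> {B<..<1}) = {0<..<1} - {A, B}"
    using AB by auto
  finally have C2: "C2_on V ({0<..<1} - {A, B})" .
  \<comment> \<open>Clamping \<open>x\<close> to \<open>[A,B]\<close> gives a formula for \<open>D\<close> without case distinction, since \<open>G' - m\<close>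
    vanishes at \<open>A\<close> and \<open>B\<close>.\<close>
  have "continuous_on {0<..<1} (\<lambda>x. deriv g x - (G' (max A (min B x)) - m))"
  proof -
    have "continuous_on {0<..<1} G'"
      by (rule DERIV_continuous_on[of _ _ q]) (auto intro: has_field_derivative_at_within deriv_G')
    then have "continuous_on {0<..<1} (\<lambda>x. G' (max A (min B x)))"
      by (rule continuous_on_compose2) (use AB in \<open>auto intro!: continuous_intros\<close>)
    moreover have "continuous_on {0<..<1} (deriv g)"
      using C2_g by (simp add: C2_on_def C1_differentiable_on_iff_deriv)
    ultimately show ?thesis by (intro continuous_intros)
  qed
  also have "(\<lambda>x. deriv g x - (G' (max A (min B x)) - m)) = D"
    using AB by (auto simp: D_def G'_def fun_eq_iff max_def min_def)
  finally have C1: "V C1_differentiable_on {0<..<1}"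
    by (intro C1_differentiable_onI[OF D])
  have "free_boundary_equations \<sigma> g c A B V"
    unfolding free_boundary_equations_def
  proof (intro conjI ballI)
    fix x assume x: "x \<in> {A<..<B}"
    have V': "(deriv V has_real_derivative - 2 * c * (1 / (\<sigma> x)\<^sup>2)) (at x)"
      by (rule has_real_derivative_deriv_cong[OF _ V_in U', of "{A<..<B}"]) (use x AB in auto)
    then show "deriv V differentiable at x"
      by (auto simp: real_differentiable_def)
    show "V differentiable at x"
      using V_in[of x] x by (auto simp: real_differentiable_def)
    show "generator \<sigma> V x = - c"
      using DERIV_imp_deriv[OF V'] sigma_nonzero[of x] x AB by (simp add: generator_def)
    show "V x < g x"
      using above[of x] x by (simp add: V_def U_def G_def)
  next
    fix x assume x: "x \<in> {A, B}"
    show "V x = g x" using x by (auto simp: V_def)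
    show "V differentiable at x" "deriv V x = deriv g x"
      using V_bd[OF x] by (auto simp: real_differentiable_def DERIV_imp_deriv)
  qed (auto simp: V_def)
  then have "regular_solution \<sigma> g c A B V"
    using C1 C2 AB by (simp add: regular_solution_def free_boundary_solution_def)
  then show ?thesis unfolding V_def[abs_def] U_def .
qed

end

theorem theorem5p1:
  fixes \<sigma> g :: "real \<Rightarrow> real" and c x0 :: real
  assumes "0 < c"
    and "diffusion_condition \<sigma>"
    and "obstacle_condition g"
    and "unimodal_condition \<sigma> g x0"
  shows "(generator \<sigma> g x0 < - c \<longrightarrow>
            (\<exists>A B V. regular_solution \<sigma> g c A B V \<and>
              (\<forall>A' B' V'. regular_solution \<sigma> g c A' B' V' \<longrightarrow>
                 A' = A \<and> B' = B \<and> (\<forall>x\<in>{0..1}. V' x = V x)))) \<and>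
         (generator \<sigma> g x0 \<ge> - c \<longrightarrow>
            (\<forall>A B V. 0 < A \<and> A \<le> B \<and> B < 1 \<and> free_boundary_equations \<sigma> g c A B V \<longrightarrow>
              A = B \<and> (\<forall>x\<in>{0..1}. V x = g x)))"
proof -
  interpret stopping_problem \<sigma> g c x0
    by standard fact+
  show ?thesis
  proof (intro conjI impI)
    assume "generator \<sigma> g x0 < - c"
    then have neg: "q x0 < 0" using q_sign(2)[OF x0] by linarith
    \<comment> \<open>Nonnegativity of \<open>g\<close> is known on the unit interval only, so
      \<open>G_at_top\<close> asks that the filters eventually stay there.\<close>
    have "eventually (\<lambda>x. x \<in> {0..1::real}) (at_right 0)"
      by (rule eventually_at_rightI[of 0 1]) auto
    moreover have "eventually (\<lambda>x. x \<in> {0..1::real}) (at_left 1)"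
      by (rule eventually_at_leftI[of 0 1]) auto
    ultimately obtain A B m b where bt: "shape.bitangent A B m b"
      using shape.bitangent_exists[OF neg] G_at_top P_at_top by metis
    let ?V = "\<lambda>x. if A < x \<and> x < B then m * x + b - 2 * c * P x else g x"
    show "\<exists>A B V. regular_solution \<sigma> g c A B V \<and>
              (\<forall>A' B' V'. regular_solution \<sigma> g c A' B' V' \<longrightarrow>
                 A' = A \<and> B' = B \<and> (\<forall>x\<in>{0..1}. V' x = V x))"
    proof (rule exI[of _ A], rule exI[of _ B], rule exI[of _ ?V], intro conjI allI impI)
      show "regular_solution \<sigma> g c A B ?V" by (rule bitangent_imp_solution[OF bt])
    next
      fix A' B' V' assume "regular_solution \<sigma> g c A' B' V'"
      then have sol: "free_boundary_solution \<sigma> g c A' B' V'"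
        by (simp add: regular_solution_def)
      obtain m' b' where bt': "shape.bitangent A' B' m' b'"
        and V': "\<And>x. A' \<le> x \<Longrightarrow> x \<le> B' \<Longrightarrow> V' x = m' * x + b' - 2 * c * P x"
        using solution_imp_bitangent[OF sol] by metis
      have eq: "A' = A" "B' = B" "m' = m" "b' = b"
        using shape.bitangent_unique[OF bt bt' neg] by auto
      then show "A' = A" "B' = B" by auto
      \<comment> \<open>Between the contacts both functions are the same line minus
        \<open>2 * c * P\<close>; elsewhere both equal \<open>g\<close>.\<close>
      show "\<forall>x\<in>{0..1}. V' x = ?V x"
        using V' sol eq
        by (auto simp: free_boundary_solution_def free_boundary_equations_def)
    qed
  next
    assume "generator \<sigma> g x0 \<ge> - c"
    then have nonneg: "0 \<le> q x0" using q_sign(2)[OF x0] by simp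
    show "\<forall>A B V. 0 < A \<and> A \<le> B \<and> B < 1 \<and> free_boundary_equations \<sigma> g c A B V \<longrightarrow>
              A = B \<and> (\<forall>x\<in>{0..1}. V x = g x)"
    proof (intro allI impI)
      fix A B V
      assume *: "0 < A \<and> A \<le> B \<and> B < 1 \<and> free_boundary_equations \<sigma> g c A B V"
      have "A = B"
      proof (rule ccontr)
        assume "A \<noteq> B"
        with * have "A < B" by simp
        \<comment> \<open>Both slopes are that of the affine function, which contradicts the strict
          growth of \<open>G'\<close>.\<close>
        with * have "G' A = G' B" using equations_imp_affine[of A B V] by metis
        with shape.G'_less_of_nonneg[of A B] * \<open>A < B\<close> nonneg show False by simp
      qed
      then show "A = B \<and> (\<forall>x\<in>{0..1}. V x = g x)"
        using * by (simp add: free_boundary_equations_def)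
    qed
  qed
qed

end
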